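(* Let $(x_n)$ be defined by $x_n=2x_{n-1}+2x_{n-2}+x_{n-3}$ with $x_0=0$, $x_1=1$, $x_2=2$. For $n\ge1$, $$\nu_2(x_n)=\begin{cases}0,& n\equiv 1,4\pmod 6,\\ 1,& n\equiv 2,3\pmod 6,\\ 2+\nu_2(n),& n\equiv 0\pmod 6,\\ 3+\nu_2(n+1),& n\equiv 5\pmod 6.\end{cases}$$
   Context: $\nu_2(m)$ denotes the exponent of the highest power of $2$ dividing the nonzero integer $m$. *)

theory Defs
  imports "HOL-Computational_Algebra.Primes" "HOL-Number_Theory.Cong"
begin

fun trib :: "nat \<Rightarrow> int" where
  "trib 0 = 0"
| "trib (Suc 0) = 1"
| "trib (Suc (Suc 0)) = 2"
| "trib (Suc (Suc (Suc n))) = 2 * trib (Suc (Suc n)) + 2 * trib (Suc n) + trib n"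

abbreviation nu2 :: "int \<Rightarrow> nat" where
  "nu2 m \<equiv> multiplicity 2 m"

end

theory Submission
  imports Defs
begin

text \<open>
  Let \<open>\<alpha>\<close> be a root of \<open>X^3 - 2 X^2 - 2 X - 1\<close>. Writing \<open>\<alpha>^N = p \<alpha>^2 + q \<alpha> + r\<close>, one has
  \<open>p = x_{N-1}\<close> and \<open>2 p + q = x_N\<close>. For \<open>N = 6\<close> the coefficients are \<open>(48, 40, 17)\<close>, and binary
  induction on \<open>m = 2^t k\<close> with \<open>k\<close> odd shows that for \<open>N = 6 m\<close> they have the form
  \<open>(2^{t+4} A, 2^{t+3} B, 1 + 2^{t+4} C)\<close> with \<open>A, B\<close> odd. This settles the residues 0 and 5;
  modulo 4 the sequence has period 6, which settles the others.
\<close>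

text \<open>Encodes \<open>\<alpha>^N = p \<alpha>^2 + q \<alpha> + r\<close> through the shift operator, avoiding the cubic ring.\<close>

definition trib_shift :: "nat \<Rightarrow> int \<Rightarrow> int \<Rightarrow> int \<Rightarrow> bool" where
  "trib_shift N p q r \<longleftrightarrow>
     (\<forall>n. trib (n + N) = p * trib (n + 2) + q * trib (n + 1) + r * trib n)"

lemma trib_rec: "trib (n + 3) = 2 * trib (n + 2) + 2 * trib (n + 1) + trib n"
  by (simp add: numeral_eq_Suc)

text \<open>Multiplies the two quadratic polynomials in the root and reduces by \<alpha>^3 = 2
  \<alpha>^2 + 2 \<alpha> + 1 and \<alpha>^4 = 6 \<alpha>^2 + 5 \<alpha> + 2.\<close>

lemma trib_shift_add:
  assumes "trib_shift N p q r" and "trib_shift M p' q' r'"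
  shows "trib_shift (N + M)
     (6 * p * p' + 2 * (p * q' + q * p') + p * r' + r * p' + q * q')
     (5 * p * p' + 2 * (p * q' + q * p') + q * r' + r * q')
     (2 * p * p' + (p * q' + q * p') + r * r')"
  unfolding trib_shift_def
proof
  fix n
  have N: "trib (k + N) = p * trib (k + 2) + q * trib (k + 1) + r * trib k" for k
    using assms(1) by (simp add: trib_shift_def)
  have "trib (n + (N + M)) = trib ((n + N) + M)"
    by (simp add: add.assoc)
  also have "\<dots> = p' * trib ((n + N) + 2) + q' * trib ((n + N) + 1) + r' * trib (n + N)"
    using assms(2) unfolding trib_shift_def by blast
  also have "\<dots> = p' * trib ((n + 2) + N) + q' * trib ((n + 1) + N) + r' * trib (n + N)"
    by (simp add: ac_simps)
  also have "\<dots> = p' * (p * trib (n + 4) + q * trib (n + 3) + r * trib (n + 2))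
      + q' * (p * trib (n + 3) + q * trib (n + 2) + r * trib (n + 1))
      + r' * (p * trib (n + 2) + q * trib (n + 1) + r * trib n)"
    unfolding N by (simp add: numeral_eq_Suc)
  also have "trib (n + 4) = 2 * trib (n + 3) + 2 * trib (n + 2) + trib (n + 1)"
    using trib_rec[of "n + 1"] by (simp add: numeral_eq_Suc)
  also note trib_rec[of n]
  finally show "trib (n + (N + M)) =
     (6 * p * p' + 2 * (p * q' + q * p') + p * r' + r * p' + q * q') * trib (n + 2) +
     (5 * p * p' + 2 * (p * q' + q * p') + q * r' + r * q') * trib (n + 1) +
     (2 * p * p' + (p * q' + q * p') + r * r') * trib n"
    by (simp add: algebra_simps)
qed

lemma trib_shift_6: "trib_shift 6 48 40 17"
  by (simp add: trib_shift_def numeral_eq_Suc)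

text \<open>Squaring, with \<open>d\<close> in the role of \<open>2 ^ t\<close>. The new
  coefficients are grouped to show that \<open>d\<close> doubles while \<open>A\<close> and
  \<open>B\<close> change by even amounts and so keep their parity.\<close>

lemma trib_shift_double:
  assumes "trib_shift N (16 * d * A) (8 * d * B) (1 + 16 * d * C)"
  shows "trib_shift (N + N)
     (32 * d * (A + 2 * (d * (24 * A * A + 8 * A * B + 8 * A * C + B * B))))
     (16 * d * (B + 2 * (d * (40 * A * A + 16 * A * B + 8 * B * C))))
     (1 + 32 * d * (C + d * (16 * A * A + 8 * A * B + 8 * C * C)))"
  using trib_shift_add[OF assms assms] by (simp add: algebra_simps)

text \<open>Starting from a doubled triple, the factor for 6, (16 * 3, 8 * 5, 1 + 16), dominates:
  the power of 2 falls back to \<open>t = 0\<close>, with cofactors congruent to 3 and 5 modulo 2,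
  hence odd.\<close>

lemma trib_shift_double_add_6:
  assumes "trib_shift N (32 * p) (16 * q) (1 + 32 * r)"
  shows "trib_shift (N + 6)
     (16 * (3 + 2 * (385 * p + 68 * q + 48 * r)))
     (8 * (5 + 2 * (640 * p + 113 * q + 80 * r)))
     (1 + 16 * (1 + 272 * p + 48 * q + 34 * r))"
  using trib_shift_add[OF assms trib_shift_6] by (simp add: algebra_simps)

text \<open>Induction from \<open>m div 2\<close>: for even \<open>m\<close> the exponent
  \<open>t\<close> rises by one and \<open>k\<close> stays; for odd \<open>m\<close> the pair
  restarts at \<open>t = 0\<close>, \<open>k = m\<close>. Only the parities of \<open>A\<close> and
  \<open>B\<close> are tracked; \<open>C\<close> is arbitrary.\<close>

lemma trib_shift_multiple_6:
  assumes "m \<ge> 1"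
  shows "\<exists>t k A B C. m = 2 ^ t * k \<and> odd k \<and> odd A \<and> odd B \<and>
           trib_shift (6 * m) (16 * 2 ^ t * A) (8 * 2 ^ t * B) (1 + 16 * 2 ^ t * C)"
  using assms
proof (induction m rule: less_induct)
  case (less m)
  show ?case
  proof (cases "m = 1")
    case True
    \<comment> \<open>Since (48, 40, 17) = (16 * 3, 8 * 5, 1 + 16 * 1), the value 1 serves for both
      \<open>k\<close> and \<open>C\<close>.\<close>
    then show ?thesis
      using trib_shift_6
      by (intro exI[of _ 0] exI[of _ 1] exI[of _ 3] exI[of _ 5]) auto
  next
    case False
    define j where "j = m div 2"
    have "j < m" "j \<ge> 1"
      using False less.prems by (auto simp: j_def)
    then obtain t k A B C where IH: "j = 2 ^ t * k" "odd k" "odd A" "odd B"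
        "trib_shift (6 * j) (16 * 2 ^ t * A) (8 * 2 ^ t * B) (1 + 16 * 2 ^ t * C)"
      using less.IH by blast
    define d :: int where "d = 2 ^ t"
    define A' where "A' = A + 2 * (d * (24 * A * A + 8 * A * B + 8 * A * C + B * B))"
    define B' where "B' = B + 2 * (d * (40 * A * A + 16 * A * B + 8 * B * C))"
    define C' where "C' = C + d * (16 * A * A + 8 * A * B + 8 * C * C)"
    have odd': "odd A'" "odd B'"
      using IH by (auto simp: A'_def B'_def)
    have dbl: "trib_shift (6 * j + 6 * j) (32 * d * A') (16 * d * B') (1 + 32 * d * C')"
      unfolding A'_def B'_def C'_def
      by (rule trib_shift_double) (use IH(5) in \<open>simp add: d_def\<close>)
    show ?thesis
    proof (cases "even m")
      case True
      then have m: "6 * m = 6 * j + 6 * j" "m = 2 * j"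
        by (auto simp: j_def)
      have "trib_shift (6 * m) (16 * 2 ^ Suc t * A') (8 * 2 ^ Suc t * B') (1 + 16 * 2 ^ Suc t * C')"
        unfolding m(1) using dbl by (simp add: d_def)
      moreover have "m = 2 ^ Suc t * k"
        using m IH by simp
      ultimately show ?thesis
        using IH odd' by blast
    next
      case False
      then have m: "6 * m = 6 * j + 6 * j + 6"
        by (auto simp: j_def elim!: oddE)
      have "trib_shift (6 * j + 6 * j) (32 * (d * A')) (16 * (d * B')) (1 + 32 * (d * C'))"
        using dbl by (simp add: mult.assoc)
      from trib_shift_double_add_6[OF this] obtain p q r where
          "trib_shift (6 * m) (16 * (3 + 2 * p)) (8 * (5 + 2 * q)) (1 + 16 * r)"
        unfolding m by blast
      then have "trib_shift (6 * m) (16 * 2 ^ 0 * (3 + 2 * p)) (8 * 2 ^ 0 * (5 + 2 * q))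
          (1 + 16 * 2 ^ 0 * r)"
        by simp
      moreover have "m = 2 ^ 0 * m" "odd (3 + 2 * p)" "odd (5 + 2 * q)"
        by simp_all
      ultimately show ?thesis
        using False by blast
    qed
  qed
qed

lemma trib_of_shift:
  assumes "trib_shift (Suc N) p q r"
  shows "trib (Suc N) = 2 * p + q" and "trib N = p"
proof -
  have *: "trib (n + Suc N) = p * trib (n + 2) + q * trib (n + 1) + r * trib n" for n
    using assms by (simp add: trib_shift_def)
  show "trib (Suc N) = 2 * p + q"
    using *[of 0] by (simp add: numeral_eq_Suc)
  \<comment> \<open>Run the recurrence backwards: x_N = x_{N+3} - 2 x_{N+2} - 2 x_{N+1} = (17p + 6q
    + 2r) - 2(6p + 2q + r) - 2(2p + q).\<close>
  then show "trib N = p"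
    using *[of 1] *[of 2] by (simp add: numeral_eq_Suc)
qed

lemma multiplicity_two_power_mult_odd:
  fixes k :: int
  assumes "odd k"
  shows "multiplicity 2 (2 ^ s * k) = s"
proof -
  have "k \<noteq> 0"
    using assms by auto
  then have "multiplicity 2 (2 ^ s * k) = multiplicity 2 (2 ^ s :: int) + multiplicity 2 k"
    by (intro prime_elem_multiplicity_mult_distrib) auto
  then show ?thesis
    using assms by (simp add: not_dvd_imp_multiplicity_0 multiplicity_same_power)
qed

lemma nu2_trib_multiple_6:
  assumes "m \<ge> 1"
  shows "nu2 (trib (6 * m)) = 2 + nu2 (int (6 * m))"
    and "nu2 (trib (6 * m - 1)) = 3 + nu2 (int (6 * m))"
proof -
  obtain t k A B C where *: "m = 2 ^ t * k" "odd k" "odd A" "odd B"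
      "trib_shift (6 * m) (16 * 2 ^ t * A) (8 * 2 ^ t * B) (1 + 16 * 2 ^ t * C)"
    using trib_shift_multiple_6[OF assms] by blast
  have S: "trib_shift (Suc (6 * m - 1)) (16 * 2 ^ t * A) (8 * 2 ^ t * B) (1 + 16 * 2 ^ t * C)"
    using * assms by simp
  have m: "int (6 * m) = 2 ^ (t + 1) * (3 * int k)"
    using * by simp
  have n6: "nu2 (int (6 * m)) = t + 1"
    unfolding m using * by (intro multiplicity_two_power_mult_odd) simp
  \<comment> \<open>Here 2p + q = 2^(t+5) A + 2^(t+3) B, and 4A + B is odd because B is.\<close>
  have x6: "trib (6 * m) = 2 ^ (t + 3) * (4 * A + B)"
    using trib_of_shift(1)[OF S] assms by (simp add: power_add algebra_simps)
  have x5: "trib (6 * m - 1) = 2 ^ (t + 4) * A"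
    using trib_of_shift(2)[OF S] by (simp add: power_add)
  show "nu2 (trib (6 * m)) = 2 + nu2 (int (6 * m))"
    unfolding n6 x6 using * by (subst multiplicity_two_power_mult_odd) simp_all
  show "nu2 (trib (6 * m - 1)) = 3 + nu2 (int (6 * m))"
    unfolding n6 x5 using * by (subst multiplicity_two_power_mult_odd) simp_all
qed

text \<open>Modulo 4 the triple (48, 40, 17) is (0, 0, 1), so a shift by 6 acts as the
  identity.\<close>

lemma trib_mod_4: "trib (6 * m + i) mod 4 = trib i mod 4"
proof (induction m)
  case (Suc m)
  have "trib (6 * Suc m + i) = trib ((6 * m + i) + 6)"
    by (simp add: algebra_simps)
  also have "\<dots> = 48 * trib (6 * m + i + 2) + 40 * trib (6 * m + i + 1) + 17 * trib (6 * m + i)"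
    using trib_shift_6 unfolding trib_shift_def by blast
  also have "\<dots> = trib (6 * m + i)
      + 4 * (12 * trib (6 * m + i + 2) + 10 * trib (6 * m + i + 1) + 4 * trib (6 * m + i))"
    by (simp add: algebra_simps)
  finally have "trib (6 * Suc m + i) mod 4 = trib (6 * m + i) mod 4"
    by (simp only: mod_mult_self2)
  then show ?case
    using Suc by simp
qed simp

lemma multiplicity_two_eq_1:
  fixes x :: int
  assumes "x mod 4 = 2"
  shows "multiplicity 2 x = 1"
proof -
  have x: "x = 2 ^ 1 * (2 * (x div 4) + 1)"
    using assms div_mult_mod_eq[of x 4] by simp
  show ?thesis
    by (subst x, rule multiplicity_two_power_mult_odd) simp
qed

theorem theorem1p10:
  fixes n :: nat
  assumes "n \<ge> 1"
  shows "([n = 1] (mod 6) \<or> [n = 4] (mod 6) \<longrightarrow> nu2 (trib n) = 0)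
       \<and> ([n = 2] (mod 6) \<or> [n = 3] (mod 6) \<longrightarrow> nu2 (trib n) = 1)
       \<and> ([n = 0] (mod 6) \<longrightarrow> nu2 (trib n) = 2 + nu2 (int n))
       \<and> ([n = 5] (mod 6) \<longrightarrow> nu2 (trib n) = 3 + nu2 (int n + 1))"
proof -
  define m where "m = n div 6"
  have n: "n = 6 * m + n mod 6"
    by (simp add: m_def)
  have mod4: "trib n mod 4 = trib (n mod 6) mod 4"
    using trib_mod_4[of m "n mod 6"] n by simp
  have trib_values: "trib 1 = 1" "trib 2 = 2" "trib 3 = 6" "trib 4 = 17"
    by (simp_all add: numeral_eq_Suc)
  have "nu2 (trib n) = 0" if "n mod 6 = 1 \<or> n mod 6 = 4"
  proof -
    have "trib n mod 4 = 1"
      using mod4 that trib_values by auto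
    then have "odd (trib n)"
      by presburger
    then show ?thesis
      by (rule not_dvd_imp_multiplicity_0)
  qed
  moreover have "nu2 (trib n) = 1" if "n mod 6 = 2 \<or> n mod 6 = 3"
    using mod4 that trib_values by (intro multiplicity_two_eq_1) auto
  \<comment> \<open>The assumption \<open>n \<ge> 1\<close> excludes \<open>m = 0\<close>.\<close>
  moreover have "nu2 (trib n) = 2 + nu2 (int n)" if "n mod 6 = 0"
    using nu2_trib_multiple_6(1)[of m] that n assms by fastforce
  moreover have "nu2 (trib n) = 3 + nu2 (int n + 1)" if "n mod 6 = 5"
  proof -
    \<comment> \<open>Residue 5 lies just below the next multiple of 6, hence
      \<open>m + 1\<close>.\<close>
    have "6 * (m + 1) - 1 = n" "int (6 * (m + 1)) = int n + 1"
      using n that by simp_all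
    then show ?thesis
      using nu2_trib_multiple_6(2)[of "m + 1"] by (metis le_add2)
  qed
  ultimately show ?thesis
    by (simp add: cong_def)
qed

end
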